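(* Let $H$ be a complex, separable, infinite dimensional Hilbert space, let $T\in L(H)$, and let $\Omega\subset\rho_\ell(T)\cap\sigma(T)$ be an open, connected subset. Suppose that there exists an extension $\tilde{T}$ of $T$ on a larger Hilbert space $\tilde{H}=H\oplus H'$ such that $\lambda I-\tilde{T}$ is invertible in $L(\tilde{H})$ for all $\lambda\in\Omega$, and write the matrix of $R(\tilde{T})(\lambda)=(\lambda I-\tilde{T})^{-1}$ with respect to the decomposition $\tilde{H}=H\oplus H'$ as $$\begin{pmatrix} L(\lambda) & S(\lambda)\\ T(\lambda) & V(\lambda)\end{pmatrix},$$ with operator-valued functions $L(\lambda):H\to H$, $S(\lambda):H'\to H$, $T(\lambda):H\to H'$, $V(\lambda):H'\to H'$. Suppose that $S(\lambda)T(\lambda)=0$ for all $\lambda\in\Omega$. Then $L(\lambda)$ is a left resolvent of $T$ in $\Omega$.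
   Context: $L(H)$ is the algebra of all continuous linear operators on a Hilbert space $H$ and $I$ is the identity operator. $\sigma(T)$ is the spectrum of $T$. The left resolvent set $\rho_\ell(T)$ is the set of all $\lambda\in\mathbb{C}$ such that $\lambda I-T$ is left invertible in $L(H)$. For $U\subseteq\rho_\ell(T)$, a map $L:U\to L(H)$ is called a left resolvent of $T$ on $U$ if $L(\lambda)(\lambda I-T)=I$ for all $\lambda\in U$ and $L(\lambda)-L(\mu)=(\mu-\lambda)L(\lambda)L(\mu)$ for all $\lambda,\mu$ in the same connected component of $U$. An extension of $T$ on $\tilde{H}=H\oplus H'$ (orthogonal direct sum of Hilbert spaces, $H$ identified with $H\oplus\{0\}$) is an operator $\tilde{T}\in L(\tilde{H})$ with $\tilde{T}h=Th$ for all $h\in H$. *)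

theory Defs
  imports "HOL-Analysis.Analysis"
begin

(* The library has no complex Hilbert spaces.  A complex inner product space is a real inner
   product space with a compatible complex scalar multiplication and a complex inner product
   (linear in the first argument) whose real part is the real inner product.  Since
   cinner x x is real by conjugate symmetry, cinner x x = inner x x = (norm x)^2, so positivity,
   definiteness and the norm are those of the class real_inner. *)
class complex_inner = real_inner +
  fixes scaleC :: "complex \<Rightarrow> 'a \<Rightarrow> 'a" (infixr "*\<^sub>C" 75)
    and cinner :: "'a \<Rightarrow> 'a \<Rightarrow> complex"
  assumes scaleC_add_right: "a *\<^sub>C (x + y) = a *\<^sub>C x + a *\<^sub>C y"
    and scaleC_add_left: "(a + b) *\<^sub>C x = a *\<^sub>C x + b *\<^sub>C x"
    and scaleC_scaleC: "a *\<^sub>C b *\<^sub>C x = (a * b) *\<^sub>C x"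
    and scaleC_one: "1 *\<^sub>C x = x"
    and scaleC_of_real: "complex_of_real r *\<^sub>C x = r *\<^sub>R x"
    and cinner_commute: "cinner x y = cnj (cinner y x)"
    and cinner_add_left: "cinner (x + y) z = cinner x z + cinner y z"
    and cinner_scaleC_left: "cinner (a *\<^sub>C x) y = a * cinner x y"
    and Re_cinner: "Re (cinner x y) = inner x y"

class complex_hilbert = complex_inner + complete_space

global_interpretation complex_vector: vector_space "scaleC :: complex \<Rightarrow> 'a \<Rightarrow> 'a::complex_inner"
  defines cspan = complex_vector.span
  by standard (simp_all add: scaleC_add_right scaleC_add_left scaleC_scaleC scaleC_one)

(* The product of two Hilbert spaces is their orthogonal direct sum:
   (h, 0) and (0, k) are orthogonal.  Norm and completeness are those of the library. *)
instantiation prod :: (complex_inner, complex_inner) complex_inner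
begin

definition scaleC_prod_def: "a *\<^sub>C x = (a *\<^sub>C fst x, a *\<^sub>C snd x)"

definition cinner_prod_def: "cinner x y = cinner (fst x) (fst y) + cinner (snd x) (snd y)"

instance
proof
  fix x y :: "'a \<times> 'b"
  show "cinner x y = cnj (cinner y x)"
    unfolding cinner_prod_def complex_cnj_add
    by (subst (1 2) cinner_commute) (rule refl)
qed (simp_all add: scaleC_prod_def cinner_prod_def scaleC_add_right scaleC_add_left
      scaleC_scaleC scaleC_one scaleC_of_real scaleR_prod_def cinner_add_left
      cinner_scaleC_left Re_cinner inner_prod_def distrib_left)

end

instance prod :: (complex_hilbert, complex_hilbert) complex_hilbert ..

definition bounded_clinear :: "('a::complex_inner \<Rightarrow> 'b::complex_inner) \<Rightarrow> bool" where
  "bounded_clinear A \<longleftrightarrow> bounded_linear A \<and> (\<forall>c x. A (c *\<^sub>C x) = c *\<^sub>C A x)"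

definition left_invertible_op :: "('a::complex_inner \<Rightarrow> 'a) \<Rightarrow> bool" where
  "left_invertible_op A \<longleftrightarrow> (\<exists>B. bounded_clinear B \<and> B \<circ> A = id)"

definition invertible_op :: "('a::complex_inner \<Rightarrow> 'a) \<Rightarrow> bool" where
  "invertible_op A \<longleftrightarrow> (\<exists>B. bounded_clinear B \<and> B \<circ> A = id \<and> A \<circ> B = id)"

definition op_shift :: "('a::complex_inner \<Rightarrow> 'a) \<Rightarrow> complex \<Rightarrow> 'a \<Rightarrow> 'a" where
  "op_shift T l = (\<lambda>x. l *\<^sub>C x - T x)"

definition op_spectrum :: "('a::complex_inner \<Rightarrow> 'a) \<Rightarrow> complex set" where
  "op_spectrum T = {l. \<not> invertible_op (op_shift T l)}"

definition left_resolvent_set :: "('a::complex_inner \<Rightarrow> 'a) \<Rightarrow> complex set" where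
  "left_resolvent_set T = {l. left_invertible_op (op_shift T l)}"

(* Only meaningful for l outside the spectrum of T, where the set-theoretic inverse is the
   inverse in L(H). *)
definition resolvent_op :: "('a::complex_inner \<Rightarrow> 'a) \<Rightarrow> complex \<Rightarrow> 'a \<Rightarrow> 'a" where
  "resolvent_op T l = inv (op_shift T l)"

definition left_resolvent_on ::
  "('a::complex_inner \<Rightarrow> 'a) \<Rightarrow> complex set \<Rightarrow> (complex \<Rightarrow> 'a \<Rightarrow> 'a) \<Rightarrow> bool" where
  "left_resolvent_on T U L \<longleftrightarrow>
     U \<subseteq> left_resolvent_set T \<and>
     (\<forall>l\<in>U. bounded_clinear (L l)) \<and>
     (\<forall>l\<in>U. L l \<circ> op_shift T l = id) \<and>
     (\<forall>l m. connected_component U l m \<longrightarrow>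
        (\<forall>x. L l x - L m x = (m - l) *\<^sub>C L l (L m x)))"

definition op_extension ::
  "('a::complex_inner \<Rightarrow> 'a) \<Rightarrow> ('a \<times> 'b::complex_inner \<Rightarrow> 'a \<times> 'b) \<Rightarrow> bool" where
  "op_extension T T' \<longleftrightarrow> bounded_clinear T' \<and> (\<forall>h. T' (h, 0) = (T h, 0))"

definition has_block_matrix ::
  "('a::complex_inner \<times> 'b::complex_inner \<Rightarrow> 'a \<times> 'b) \<Rightarrow>
   ('a \<Rightarrow> 'a) \<Rightarrow> ('b \<Rightarrow> 'a) \<Rightarrow> ('a \<Rightarrow> 'b) \<Rightarrow> ('b \<Rightarrow> 'b) \<Rightarrow> bool" where
  "has_block_matrix R A B C D \<longleftrightarrow>
     bounded_clinear A \<and> bounded_clinear B \<and> bounded_clinear C \<and> bounded_clinear D \<and>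
     (\<forall>h k. R (h, k) = (A h + B k, C h + D k))"

end

theory Submission
  imports Defs
begin

text \<open>
  Write \<open>R\<close> for the resolvent of the extension. The upper left corner of the resolvent identity
  \<open>R \<lambda> - R \<mu> = (\<mu> - \<lambda>) R \<lambda> R \<mu>\<close> reads
  \<open>L \<lambda> - L \<mu> = (\<mu> - \<lambda>) (L \<lambda> L \<mu> + S \<lambda> C \<mu>)\<close>, so \<open>L\<close> is a left resolvent as soon as \<open>S \<lambda> C \<mu>\<close>
  vanishes for distinct \<open>\<lambda>\<close> and \<open>\<mu>\<close>, whereas the hypothesis only gives this on the diagonal.
  The diagonal hypothesis nevertheless amounts to \<open>L' = - L\<^sup>2\<close>. Fix \<open>\<mu>\<close>; then the defect
  \<open>F \<lambda> = L \<lambda> (1 + (\<lambda> - \<mu>) L \<mu>) - L \<mu>\<close> satisfies the linear differential equation \<open>F' = - L F\<close> with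
  \<open>F \<mu> = 0\<close>, and uniqueness of solutions propagates the zero through the connected set \<open>\<Omega>\<close>.

  Derivatives can be avoided. Apply \<open>S \<lambda>\<close> to the lower left corner of the resolvent identity; the
  hypothesis then yields \<open>S \<lambda> C \<nu> = (\<lambda> - \<nu>) S \<lambda> V \<lambda> C \<nu>\<close>, and therefore the differential
  equation holds in the discrete form
  \<open>F \<lambda> - F \<nu> = (\<nu> - \<lambda>) L \<lambda> F \<nu> - (\<lambda> - \<nu>)\<^sup>2 S \<lambda> V \<lambda> C \<nu> (1 + (\<nu> - \<mu>) L \<mu>)\<close>
  (\<open>defect_increment\<close>). The resolvent is locally bounded (\<open>resolvent_locally_bounded\<close>), so locally
  this is a Gronwall inequality with an error of second order (\<open>discrete_gronwall_zero\<close>), which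
  leaves no room for \<open>F\<close> to leave zero.
\<close>

section \<open>Complex scalars and bounded operators\<close>

lemma norm_scaleC: "norm (a *\<^sub>C x) = cmod a * norm (x :: 'a::complex_inner)"
proof -
  have "cinner (a *\<^sub>C x) (a *\<^sub>C x) = a * cnj (cinner (a *\<^sub>C x) x)"
    by (metis cinner_commute cinner_scaleC_left)
  also have "\<dots> = (a * cnj a) * cinner x x"
    by (metis cinner_commute cinner_scaleC_left complex_cnj_mult mult.assoc)
  also have "a * cnj a = complex_of_real ((cmod a)\<^sup>2)"
    using complex_norm_square[of a] by simp
  finally have "Re (cinner (a *\<^sub>C x) (a *\<^sub>C x)) = (cmod a)\<^sup>2 * Re (cinner x x)"
    by simp
  then have "(norm (a *\<^sub>C x))\<^sup>2 = (cmod a * norm x)\<^sup>2"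
    by (simp add: Re_cinner power2_norm_eq_inner power_mult_distrib)
  then show ?thesis by simp
qed

lemma bounded_clinear_simps:
  assumes "bounded_clinear A"
  shows "A (x + y) = A x + A y" "A (x - y) = A x - A y" "A 0 = 0" "A (c *\<^sub>C x) = c *\<^sub>C A x"
proof -
  have lin: "bounded_linear A" and hom: "\<forall>c x. A (c *\<^sub>C x) = c *\<^sub>C A x"
    using assms by (simp_all add: bounded_clinear_def)
  interpret bounded_linear A by (rule lin)
  show "A (x + y) = A x + A y" "A (x - y) = A x - A y" "A 0 = 0"
    by (simp_all add: add diff zero)
  show "A (c *\<^sub>C x) = c *\<^sub>C A x" using hom by simp
qed

section \<open>The resolvent\<close>

lemma op_shift_resolvent_op:
  assumes "invertible_op (op_shift A z)"
  shows "op_shift A z (resolvent_op A z x) = x" "resolvent_op A z (op_shift A z x) = x"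
proof -
  have "bij (op_shift A z)"
    using assms unfolding invertible_op_def by (metis o_bij)
  then show "op_shift A z (resolvent_op A z x) = x" "resolvent_op A z (op_shift A z x) = x"
    by (simp_all add: resolvent_op_def bij_is_surj surj_f_inv_f bij_is_inj inv_f_f)
qed

lemma bounded_clinear_resolvent_op:
  assumes "invertible_op (op_shift A z)"
  shows "bounded_clinear (resolvent_op A z)"
proof -
  obtain B where B: "bounded_clinear B" "B \<circ> op_shift A z = id" "op_shift A z \<circ> B = id"
    using assms unfolding invertible_op_def by blast
  have "resolvent_op A z = B"
    using inv_unique_comp[OF B(3) B(2)] by (simp add: resolvent_op_def)
  with B(1) show ?thesis by simp
qed

lemma resolvent_identity:
  assumes "invertible_op (op_shift A z)" "invertible_op (op_shift A w)"
  shows "resolvent_op A z x - resolvent_op A w x = (w - z) *\<^sub>C resolvent_op A z (resolvent_op A w x)"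
proof -
  let ?R = "resolvent_op A"
  define y where "y = ?R w x"
  have x: "x = op_shift A w y" using op_shift_resolvent_op[OF assms(2)] by (simp add: y_def)
  have "op_shift A w y = (w - z) *\<^sub>C y + op_shift A z y"
    by (simp add: op_shift_def complex_vector.scale_left_diff_distrib)
  then have "?R z x = (w - z) *\<^sub>C ?R z y + y"
    using x bounded_clinear_simps[OF bounded_clinear_resolvent_op[OF assms(1)]]
      op_shift_resolvent_op[OF assms(1)]
    by simp
  then show ?thesis by (simp add: y_def)
qed

text \<open>
  A lower bound for \<open>a - A\<close> survives a perturbation of \<open>a\<close> that is small against it, and a lower
  bound for an invertible operator is an upper bound for its inverse.
\<close>

lemma resolvent_locally_bounded:
  assumes inv_a: "invertible_op (op_shift A a)"
  obtains K r where "K > 0" "r > 0"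
    "\<And>z x. z \<in> ball a r \<Longrightarrow> invertible_op (op_shift A z) \<Longrightarrow> norm (resolvent_op A z x) \<le> K * norm x"
proof -
  let ?R = "resolvent_op A"
  have "bounded_linear (?R a)"
    using bounded_clinear_resolvent_op[OF inv_a] by (simp add: bounded_clinear_def)
  then obtain M where M: "M > 0" "\<And>x. norm (?R a x) \<le> norm x * M"
    using bounded_linear.pos_bounded by blast
  show ?thesis
  proof (rule that)
    show "2 * M > 0" "1 / (2 * M) > 0" using M(1) by simp_all
    fix z x
    assume z: "z \<in> ball a (1 / (2 * M))" and inv_z: "invertible_op (op_shift A z)"
    define y where "y = ?R z x"
    have x: "op_shift A z y = x" using op_shift_resolvent_op[OF inv_z] by (simp add: y_def)
    have "op_shift A a y = (a - z) *\<^sub>C y + x"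
      unfolding x[symmetric] by (simp add: op_shift_def complex_vector.scale_left_diff_distrib)
    then have "norm (op_shift A a y) \<le> cmod (a - z) * norm y + norm x"
      by (metis norm_triangle_ineq norm_scaleC)
    moreover have "norm y \<le> norm (op_shift A a y) * M"
      using M(2)[of "op_shift A a y"] op_shift_resolvent_op[OF inv_a] by simp
    ultimately have "norm y \<le> (cmod (a - z) * norm y + norm x) * M"
      using M(1) by (meson mult_right_mono less_imp_le order_trans)
    also have "\<dots> = (cmod (a - z) * M) * norm y + norm x * M"
      by (simp add: algebra_simps)
    also have "(cmod (a - z) * M) * norm y \<le> 1 / 2 * norm y"
      using z M(1) by (intro mult_right_mono) (auto simp: dist_norm field_simps)
    finally show "norm (?R z x) \<le> 2 * M * norm x"
      by (simp add: y_def algebra_simps)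
  qed
qed

section \<open>Discrete Gronwall inequality\<close>

text \<open>
  Cut the segment from \<open>x\<close> to \<open>y\<close> into \<open>n\<close> equal pieces. At each division point the second order
  error enters once, of size \<open>O(1/n\<^sup>2)\<close>, and the growth factors \<open>1 + 1/(2n)\<close> amplify it by at most
  a constant, so that \<open>f y = O(1/n)\<close>.
\<close>

lemma discrete_gronwall_zero:
  fixes f :: "'a::real_normed_vector \<Rightarrow> 'b::real_normed_vector"
  assumes "convex B" "x \<in> B" "y \<in> B" and fx: "f x = 0"
    and step: "\<And>u v. u \<in> B \<Longrightarrow> v \<in> B \<Longrightarrow>
      norm (f v - f u) \<le> K * dist u v * norm (f u) + Q * (dist u v)\<^sup>2"
    and small: "K * dist x y \<le> 1 / 2"
  shows "f y = 0"
proof -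
  define E where "E = \<bar>Q\<bar> * (dist x y)\<^sup>2"
  have E: "E \<ge> 0" by (simp add: E_def)
  have bound: "norm (f y) \<le> 2 * E / n" if n: "n > 0" for n :: nat
  proof -
    define p where "p j = x + (real j / n) *\<^sub>R (y - x)" for j :: nat
    have pB: "p j \<in> B" if "j \<le> n" for j
    proof -
      have "p j = (1 - real j / n) *\<^sub>R x + (real j / n) *\<^sub>R y"
        by (simp add: p_def algebra_simps)
      then show ?thesis
        using that n assms(1-3) by (simp add: convexD_alt)
    qed
    have d: "dist (p j) (p (Suc j)) = dist x y / n" for j
    proof -
      have "p (Suc j) - p j = (1 / n) *\<^sub>R (y - x)"
        by (simp add: p_def add_divide_distrib scaleR_add_left)
      then have "norm (p (Suc j) - p j) = norm (y - x) / n" by simp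
      then show ?thesis
        by (simp add: dist_norm norm_minus_commute)
    qed
    \<comment> \<open>Half of the factor 2 absorbs the amplification, because \<open>j \<le> n\<close>.\<close>
    have "j \<le> n \<Longrightarrow> norm (f (p j)) \<le> 2 * real j * (E / n\<^sup>2)" for j
    proof (induction j)
      case 0
      then show ?case by (simp add: p_def fx)
    next
      case (Suc j)
      let ?e = "norm (f (p j))"
      have "norm (f (p (Suc j)) - f (p j))
          \<le> K * (dist x y / n) * ?e + Q * (dist x y / n)\<^sup>2"
        using step[of "p j" "p (Suc j)"] pB Suc.prems by (simp add: d)
      also have "K * (dist x y / n) * ?e \<le> 1 / (2 * n) * ?e"
        using small n by (intro mult_right_mono) (simp_all add: field_simps)
      also have "Q * (dist x y / n)\<^sup>2 \<le> E / n\<^sup>2"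
        by (simp add: E_def power_divide divide_right_mono mult_right_mono)
      finally have "norm (f (p (Suc j))) \<le> ?e + 1 / (2 * n) * ?e + E / n\<^sup>2"
        using norm_triangle_sub[of "f (p (Suc j))" "f (p j)"] by linarith
      moreover have e: "?e \<le> 2 * real j * (E / n\<^sup>2)" using Suc by simp
      moreover have "1 / (2 * n) * ?e \<le> E / n\<^sup>2"
      proof -
        have "1 / (2 * n) * ?e \<le> 1 / (2 * n) * (2 * real j * (E / n\<^sup>2))"
          using e by (rule mult_left_mono) simp
        also have "\<dots> = real j / n * (E / n\<^sup>2)" by simp
        also have "\<dots> \<le> 1 * (E / n\<^sup>2)"
          using Suc.prems n E by (intro mult_right_mono) simp_all
        finally show ?thesis by simp
      qed
      ultimately have "norm (f (p (Suc j))) \<le> 2 * real j * (E / n\<^sup>2) + 2 * (E / n\<^sup>2)"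
        by linarith
      then show ?case by (simp add: algebra_simps)
    qed
    from this[of n] show ?thesis
      using n by (simp add: p_def power2_eq_square)
  qed
  have "(\<lambda>n. 2 * E / real n) \<longlonglongrightarrow> 0" by (rule lim_const_over_n)
  moreover have "\<forall>\<^sub>F n in sequentially. norm (f y) \<le> 2 * E / real n"
    using eventually_gt_at_top[of 0] by eventually_elim (rule bound)
  ultimately have "norm (f y) \<le> 0"
    by (intro tendsto_lowerbound[of _ 0 sequentially]) simp_all
  then show ?thesis by simp
qed

section \<open>Block matrices of the resolvent\<close>

lemma has_block_matrixD:
  assumes "has_block_matrix R A B C D"
  shows "bounded_clinear A" "bounded_clinear B" "bounded_clinear C" "bounded_clinear D"
    and "R (h, k) = (A h + B k, C h + D k)"
  using assms by (auto simp: has_block_matrix_def)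

lemma norm_blocks_le:
  assumes m: "has_block_matrix R A B C D" and K: "\<And>x. norm (R x) \<le> K * norm x"
  shows "norm (A h) \<le> K * norm h" "norm (B k) \<le> K * norm k"
    "norm (C h) \<le> K * norm h" "norm (D k) \<le> K * norm k"
proof -
  note zero = bounded_clinear_simps(3)[OF has_block_matrixD(1)[OF m]]
    bounded_clinear_simps(3)[OF has_block_matrixD(2)[OF m]]
    bounded_clinear_simps(3)[OF has_block_matrixD(3)[OF m]]
    bounded_clinear_simps(3)[OF has_block_matrixD(4)[OF m]]
  have "R (h, 0) = (A h, C h)" "R (0, k) = (B k, D k)"
    by (simp_all add: has_block_matrixD(5)[OF m] zero)
  then have "norm (A h, C h) \<le> K * norm h" "norm (B k, D k) \<le> K * norm k"
    using K[of "(h, 0)"] K[of "(0, k)"] by (simp_all add: norm_Pair)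
  then show "norm (A h) \<le> K * norm h" "norm (B k) \<le> K * norm k"
    "norm (C h) \<le> K * norm h" "norm (D k) \<le> K * norm k"
    using norm_fst_le[of "A h" "C h"] norm_snd_le[of "C h" "A h"]
      norm_fst_le[of "B k" "D k"] norm_snd_le[of "D k" "B k"]
    by linarith+
qed

lemma resolvent_identity_blocks:
  assumes inv: "invertible_op (op_shift A z)" "invertible_op (op_shift A w)"
    and mz: "has_block_matrix (resolvent_op A z) Lz Sz Cz Vz"
    and mw: "has_block_matrix (resolvent_op A w) Lw Sw Cw Vw"
  shows "Lz h - Lw h = (w - z) *\<^sub>C (Lz (Lw h) + Sz (Cw h))"
    and "Cz h - Cw h = (w - z) *\<^sub>C (Cz (Lw h) + Vz (Cw h))"
proof -
  note zero = bounded_clinear_simps(3)[OF has_block_matrixD(2)[OF mz]]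
    bounded_clinear_simps(3)[OF has_block_matrixD(4)[OF mz]]
    bounded_clinear_simps(3)[OF has_block_matrixD(2)[OF mw]]
    bounded_clinear_simps(3)[OF has_block_matrixD(4)[OF mw]]
  show "Lz h - Lw h = (w - z) *\<^sub>C (Lz (Lw h) + Sz (Cw h))"
    and "Cz h - Cw h = (w - z) *\<^sub>C (Cz (Lw h) + Vz (Cw h))"
    using resolvent_identity[OF inv, of "(h, 0)"]
    by (simp_all add: has_block_matrixD(5)[OF mz] has_block_matrixD(5)[OF mw] zero scaleC_prod_def)
qed

text \<open>
  The extension maps \<open>H\<close> into itself by \<open>T\<close>, so the first column of \<open>R (\<lambda> - T') = 1\<close> involves only
  the first column of \<open>R\<close>.
\<close>

lemma corner_left_inverse:
  assumes ext: "op_extension T T'" and inv: "invertible_op (op_shift T' z)"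
    and m: "has_block_matrix (resolvent_op T' z) L S C V"
  shows "L (op_shift T z h) = h"
proof -
  have "op_shift T' z (h, 0) = (op_shift T z h, 0)"
    using ext by (simp add: op_extension_def op_shift_def scaleC_prod_def)
  then have "resolvent_op T' z (op_shift T z h, 0) = (h, 0)"
    using op_shift_resolvent_op(2)[OF inv, of "(h, 0)"] by simp
  then show ?thesis
    by (simp add: has_block_matrixD(5)[OF m] bounded_clinear_simps(3)[OF has_block_matrixD(2)[OF m]])
qed

section \<open>Propagation of the left resolvent identity\<close>

text \<open>
  This is the equation \<open>F' = - L F\<close> with an explicit remainder, for
  \<open>F \<lambda> = L \<lambda> (h + (\<lambda> - \<mu>) v) - v\<close>; the choice \<open>v = L \<mu> h\<close> makes it the defect of the left
  resolvent identity. The quadratic factor in the remainder arises because \<open>S \<lambda> C \<nu>\<close> itself is of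
  first order in \<open>\<lambda> - \<nu>\<close>: by the hypothesis on \<open>S \<lambda> C \<lambda>\<close> only the difference \<open>C \<nu> - C \<lambda>\<close> counts.
\<close>

lemma defect_increment:
  assumes inv: "invertible_op (op_shift A z)" "invertible_op (op_shift A w)"
    and mz: "has_block_matrix (resolvent_op A z) Lz Sz Cz Vz"
    and mw: "has_block_matrix (resolvent_op A w) Lw Sw Cw Vw"
    and SC: "\<And>h. Sz (Cz h) = 0"
  shows "(Lz (h + (z - m) *\<^sub>C v) - v) - (Lw (h + (w - m) *\<^sub>C v) - v) =
    (w - z) *\<^sub>C Lz (Lw (h + (w - m) *\<^sub>C v) - v)
    - (z - w)\<^sup>2 *\<^sub>C Sz (Vz (Cw (h + (w - m) *\<^sub>C v)))"
proof -
  define p where "p = h + (w - m) *\<^sub>C v"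
  note L = bounded_clinear_simps[OF has_block_matrixD(1)[OF mz]]
  note S = bounded_clinear_simps[OF has_block_matrixD(2)[OF mz]]
  have "Sz (Cw p) = - Sz (Cz p - Cw p)"
    by (simp add: S SC)
  also have "\<dots> = (z - w) *\<^sub>C Sz (Vz (Cw p))"
    unfolding resolvent_identity_blocks(2)[OF inv mz mw]
    by (subst minus_diff_eq[of w z, symmetric]) (simp add: S SC del: minus_diff_eq)
  finally have first_order: "Sz (Cw p) = (z - w) *\<^sub>C Sz (Vz (Cw p))" .
  have "h + (z - m) *\<^sub>C v = p + (z - w) *\<^sub>C v"
    by (simp add: p_def scaleC_add_left[symmetric])
  then have "(Lz (h + (z - m) *\<^sub>C v) - v) - (Lw p - v) = (Lz p - Lw p) + (z - w) *\<^sub>C Lz v"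
    by (simp add: L)
  also have "\<dots> = (w - z) *\<^sub>C Lz (Lw p) + (w - z) *\<^sub>C (z - w) *\<^sub>C Sz (Vz (Cw p)) + (z - w) *\<^sub>C Lz v"
    unfolding resolvent_identity_blocks(1)[OF inv mz mw] first_order
    by (simp add: scaleC_add_right)
  also have "(w - z) *\<^sub>C (z - w) *\<^sub>C Sz (Vz (Cw p)) = - ((z - w)\<^sup>2 *\<^sub>C Sz (Vz (Cw p)))"
  proof -
    have "(w - z) * (z - w) = - ((z - w)\<^sup>2)"
      by (simp add: power2_eq_square algebra_simps)
    then show ?thesis by (simp add: scaleC_scaleC)
  qed
  also have "(z - w) *\<^sub>C Lz v = - ((w - z) *\<^sub>C Lz v)"
    by (subst minus_diff_eq[of w z, symmetric]) (rule complex_vector.scale_minus_left)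
  finally show ?thesis
    by (simp add: p_def[symmetric] L complex_vector.scale_right_diff_distrib)
qed

text \<open>
  The radius is chosen so small against the local bound of the resolvent that any two points
  of the ball satisfy the smallness condition of the Gronwall inequality.
\<close>

lemma defect_zero_propagates_in_ball:
  assumes \<Omega>: "open \<Omega>" "a \<in> \<Omega>"
    and inv: "\<And>z. z \<in> \<Omega> \<Longrightarrow> invertible_op (op_shift A z)"
    and matrix: "\<And>z. z \<in> \<Omega> \<Longrightarrow> has_block_matrix (resolvent_op A z) (L z) (S z) (C z) (V z)"
    and SC: "\<And>z h. z \<in> \<Omega> \<Longrightarrow> S z (C z h) = 0"
  obtains r where "r > 0" "ball a r \<subseteq> \<Omega>"
    "\<And>x y. x \<in> ball a r \<Longrightarrow> y \<in> ball a r \<Longrightarrow>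
      L x (h + (x - m) *\<^sub>C v) - v = 0 \<Longrightarrow> L y (h + (y - m) *\<^sub>C v) - v = 0"
proof -
  obtain K r1 where K: "K > 0" "r1 > 0"
    "\<And>z x. z \<in> ball a r1 \<Longrightarrow> invertible_op (op_shift A z) \<Longrightarrow> norm (resolvent_op A z x) \<le> K * norm x"
    using resolvent_locally_bounded[OF inv[OF \<Omega>(2)]] by blast
  obtain r2 where r2: "r2 > 0" "ball a r2 \<subseteq> \<Omega>"
    using \<Omega> by (meson open_contains_ball)
  define r where "r = Min {r1, r2, 1 / (4 * K)}"
  have r: "r > 0" "r \<le> r1" "r \<le> r2" "r \<le> 1 / (4 * K)"
    using K(1,2) r2(1) by (auto simp: r_def)
  have sub: "ball a r \<subseteq> \<Omega>" using r(3) r2(2) by auto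
  define F where "F z = L z (h + (z - m) *\<^sub>C v) - v" for z
  define P where "P = norm h + (r + cmod (a - m)) * norm v"
  have bound: "norm (F z - F w) \<le> K * dist w z * norm (F w) + (K * (K * (K * P))) * (dist w z)\<^sup>2"
    if w: "w \<in> ball a r" and z: "z \<in> ball a r" for w z
  proof -
    define p where "p = h + (w - m) *\<^sub>C v"
    have in_\<Omega>: "w \<in> \<Omega>" "z \<in> \<Omega>" using w z sub by auto
    have Rz: "norm (resolvent_op A z x) \<le> K * norm x"
      and Rw: "norm (resolvent_op A w x) \<le> K * norm x" for x
      using K(3) inv in_\<Omega> w z r(2) by auto
    note nz = norm_blocks_le[OF matrix[OF in_\<Omega>(2)] Rz]
    note nw = norm_blocks_le[OF matrix[OF in_\<Omega>(1)] Rw]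
    have "cmod (w - m) \<le> r + cmod (a - m)"
      using w norm_triangle_ineq[of "w - a" "a - m"] by (simp add: dist_norm norm_minus_commute)
    then have "norm p \<le> P"
      unfolding p_def P_def
      by (intro order_trans[OF norm_triangle_ineq] add_left_mono)
        (simp add: norm_scaleC mult_right_mono)
    then have "norm (S z (V z (C w p))) \<le> K * (K * (K * P))"
      using K(1) by (intro order_trans[OF nz(2)] order_trans[OF nz(4)] order_trans[OF nw(3)] mult_left_mono)
        simp_all
    moreover have "F z - F w = (w - z) *\<^sub>C L z (F w) - (z - w)\<^sup>2 *\<^sub>C S z (V z (C w p))"
      unfolding F_def p_def
      by (rule defect_increment[OF inv[OF in_\<Omega>(2)] inv[OF in_\<Omega>(1)]
            matrix[OF in_\<Omega>(2)] matrix[OF in_\<Omega>(1)] SC[OF in_\<Omega>(2)]])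
    then have "norm (F z - F w)
        \<le> cmod (w - z) * norm (L z (F w)) + (cmod (w - z))\<^sup>2 * norm (S z (V z (C w p)))"
      using norm_triangle_ineq4[of "(w - z) *\<^sub>C L z (F w)" "(z - w)\<^sup>2 *\<^sub>C S z (V z (C w p))"]
      by (simp add: norm_scaleC norm_power norm_minus_commute)
    ultimately have "norm (F z - F w)
        \<le> cmod (w - z) * (K * norm (F w)) + (cmod (w - z))\<^sup>2 * (K * (K * (K * P)))"
      by (meson nz(1) add_mono mult_left_mono norm_ge_zero order_trans zero_le_power2)
    then show ?thesis by (simp add: dist_norm mult_ac)
  qed
  show ?thesis
  proof (rule that[OF r(1) sub])
    fix x y
    assume xy: "x \<in> ball a r" "y \<in> ball a r" and zero: "L x (h + (x - m) *\<^sub>C v) - v = 0"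
    have "dist x y < 2 * r"
      using xy dist_triangle3[of x y a] by simp
    then have "dist x y \<le> 1 / (2 * K)"
      using r(4) by simp
    then have "K * dist x y \<le> 1 / 2"
      using K(1) by (simp add: field_simps)
    then have "F y = 0"
      using discrete_gronwall_zero[OF convex_ball xy _ bound] zero by (simp add: F_def)
    then show "L y (h + (y - m) *\<^sub>C v) - v = 0" by (simp add: F_def)
  qed
qed

theorem theorem3p3:
  fixes T :: "'h::complex_hilbert \<Rightarrow> 'h"
    and T' :: "'h \<times> 'k::complex_hilbert \<Rightarrow> 'h \<times> 'k"
    and \<Omega> :: "complex set"
    and L :: "complex \<Rightarrow> 'h \<Rightarrow> 'h"
    and S :: "complex \<Rightarrow> 'k \<Rightarrow> 'h"
    and C :: "complex \<Rightarrow> 'h \<Rightarrow> 'k"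
    and V :: "complex \<Rightarrow> 'k \<Rightarrow> 'k"
  assumes separable: "separable_space (euclidean :: 'h topology)"
    and infinite_dimensional: "\<nexists>B :: 'h set. finite B \<and> cspan B = UNIV"
    and T: "bounded_clinear T"
    and \<Omega>: "\<Omega> \<subseteq> left_resolvent_set T \<inter> op_spectrum T" "open \<Omega>" "connected \<Omega>"
    and extension: "op_extension T T'"
    and invertible: "\<And>z. z \<in> \<Omega> \<Longrightarrow> invertible_op (op_shift T' z)"
    and matrix: "\<And>z. z \<in> \<Omega> \<Longrightarrow>
      has_block_matrix (resolvent_op T' z) (L z) (S z) (C z) (V z)"
    and SC: "\<And>z h. z \<in> \<Omega> \<Longrightarrow> S z (C z h) = 0"
  shows "left_resolvent_on T \<Omega> L"
proof -
  have identity: "L l h - L m h = (m - l) *\<^sub>C L l (L m h)" if l: "l \<in> \<Omega>" and m: "m \<in> \<Omega>" for l m h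
  proof -
    let ?Z = "\<lambda>z. L z (h + (z - m) *\<^sub>C L m h) - L m h = 0"
    have "\<exists>U. openin (top_of_set \<Omega>) U \<and> a \<in> U \<and> (\<forall>x\<in>U. \<forall>y\<in>U. ?Z x \<longrightarrow> ?Z y)" if a: "a \<in> \<Omega>" for a
    proof -
      obtain r where r: "r > 0" "ball a r \<subseteq> \<Omega>"
        and propagate: "\<And>x y. x \<in> ball a r \<Longrightarrow> y \<in> ball a r \<Longrightarrow> ?Z x \<Longrightarrow> ?Z y"
        using defect_zero_propagates_in_ball[OF \<Omega>(2) a invertible matrix SC] by blast
      show ?thesis
      proof (intro exI conjI)
        show "openin (top_of_set \<Omega>) (ball a r)" using r(2) by (simp add: open_subset)
        show "a \<in> ball a r" using r(1) by simp
        show "\<forall>x\<in>ball a r. \<forall>y\<in>ball a r. ?Z x \<longrightarrow> ?Z y" using propagate by blast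
      qed
    qed
    moreover have "?Z m" by simp
    ultimately have "?Z l"
      using connected_induction_simple[OF \<Omega>(3) m l, of ?Z] by blast
    moreover have "m - l = - (l - m)" by simp
    ultimately show ?thesis
      unfolding \<open>m - l = - (l - m)\<close> complex_vector.scale_minus_left
      by (simp add: bounded_clinear_simps[OF has_block_matrixD(1)[OF matrix[OF l]]] algebra_simps)
  qed
  show ?thesis
    unfolding left_resolvent_on_def
  proof (intro conjI ballI allI impI)
    show "\<Omega> \<subseteq> left_resolvent_set T" using \<Omega>(1) by simp
    show "bounded_clinear (L l)" if "l \<in> \<Omega>" for l
      using has_block_matrixD(1)[OF matrix[OF that]] .
    show "L l \<circ> op_shift T l = id" if "l \<in> \<Omega>" for l
      using corner_left_inverse[OF extension invertible[OF that] matrix[OF that]] by auto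
    show "L l x - L m x = (m - l) *\<^sub>C L l (L m x)" if "connected_component \<Omega> l m" for l m x
      using identity connected_component_in[OF that] by blast
  qed
qed

end
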